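(* Let $X$ be a complex Banach space and let $T\in B(X)$ be a compact well-bounded operator with sum representation $T=\sum_j\mu_jP_j$, where $|\mu_1|\ge|\mu_2|\ge\cdots$. Let $\pi$ be a permutation of the positive integers. Then $$T=\sum_j\mu_{\pi(j)}P_{\pi(j)}$$ if the sum on the right-hand side converges (in the operator norm).
   Context: $B(X)$ is the algebra of bounded linear operators on $X$. An operator $T\in B(X)$ is well-bounded if there are a compact interval $[a,b]\subset\mathbb{R}$ and a constant $C$ such that $\|p(T)\|\le C\bigl(|p(b)|+\int_a^b|p'(t)|\,dt\bigr)$ for all polynomials $p$ (equivalently, $T$ has an $AC[a,b]$ functional calculus); its spectrum is then real. Sum representation: it is known that every compact well-bounded operator $T$ can be written as a norm-convergent sum $T=\sum_{j=1}^\infty\mu_jP_j$, where $\mu_1,\mu_2,\dots$ are the distinct nonzero eigenvalues of $T$ listed so that $|\mu_j|$ is nonincreasing, and $P_j$ is the (finite rank) Riesz projection onto the eigenspace of $T$ corresponding to $\mu_j$. (If there are only finitely many nonzero eigenvalues the remaining terms are taken to be zero.) *)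

theory Defs
  imports
    "HOL-Complex_Analysis.Complex_Analysis"
    "HOL-Computational_Algebra.Polynomial"
begin

section \<open>Complex Banach spaces\<close>

text \<open>
  A complex normed space is a real normed space with a scalar multiplication by complex numbers
  that extends the real one.
\<close>

class complex_normed_vector = real_normed_vector +
  fixes scaleC :: "complex \<Rightarrow> 'a \<Rightarrow> 'a"  (infixr \<open>*\<^sub>C\<close> 75)
  assumes scaleC_add_right: "c *\<^sub>C (x + y) = c *\<^sub>C x + c *\<^sub>C y"
    and scaleC_add_left: "(c + d) *\<^sub>C x = c *\<^sub>C x + d *\<^sub>C x"
    and scaleC_scaleC: "c *\<^sub>C d *\<^sub>C x = (c * d) *\<^sub>C x"
    and scaleC_of_real: "of_real r *\<^sub>C x = r *\<^sub>R x"
    and norm_scaleC: "norm (c *\<^sub>C x) = cmod c * norm x"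

class complex_banach = complex_normed_vector + banach

lemma bounded_linear_scaleC:
  "bounded_linear (\<lambda>x::'a::complex_normed_vector. c *\<^sub>C x)"
proof (rule bounded_linear_intro[where K = "cmod c"])
  fix r :: real and x :: 'a
  show "c *\<^sub>C r *\<^sub>R x = r *\<^sub>R c *\<^sub>C x"
    by (metis scaleC_of_real scaleC_scaleC mult.commute)
qed (simp_all add: scaleC_add_right norm_scaleC mult.commute)

instantiation blinfun :: (real_normed_vector, complex_normed_vector) complex_normed_vector
begin

lift_definition scaleC_blinfun :: "complex \<Rightarrow> ('a \<Rightarrow>\<^sub>L 'b) \<Rightarrow> 'a \<Rightarrow>\<^sub>L 'b"
  is "\<lambda>c f x. c *\<^sub>C f x"
  by (rule bounded_linear_compose[OF bounded_linear_scaleC])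

instance
proof
  fix c d :: complex and r :: real and f g :: "'a \<Rightarrow>\<^sub>L 'b"
  show "c *\<^sub>C (f + g) = c *\<^sub>C f + c *\<^sub>C g"
    by transfer (simp add: scaleC_add_right)
  show "(c + d) *\<^sub>C f = c *\<^sub>C f + d *\<^sub>C f"
    by transfer (simp add: scaleC_add_left)
  show "c *\<^sub>C d *\<^sub>C f = (c * d) *\<^sub>C f"
    by transfer (simp add: scaleC_scaleC)
  show "of_real r *\<^sub>C f = r *\<^sub>R f"
    by transfer (simp add: scaleC_of_real)
  have le: "norm (e *\<^sub>C h) \<le> cmod e * norm h" for e and h :: "'a \<Rightarrow>\<^sub>L 'b"
  proof (rule norm_blinfun_bound)
    show "norm (blinfun_apply (e *\<^sub>C h) x) \<le> cmod e * norm h * norm x" for x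
      using mult_left_mono[OF norm_blinfun[of h x], of "cmod e"]
      by (simp add: scaleC_blinfun.rep_eq norm_scaleC mult.assoc)
  qed simp
  show "norm (c *\<^sub>C f) = cmod c * norm f"
  proof (cases "c = 0")
    case True
    then show ?thesis using le[of c f] by simp
  next
    case False
    have "inverse c *\<^sub>C c *\<^sub>C f x = f x" for x
      using False scaleC_of_real[of 1 "f x"] by (simp add: scaleC_scaleC)
    then have "f = inverse c *\<^sub>C c *\<^sub>C f"
      by (intro blinfun_eqI) (simp add: scaleC_blinfun.rep_eq)
    then have "norm f \<le> cmod (inverse c) * norm (c *\<^sub>C f)"
      by (metis le)
    then have "cmod c * norm f \<le> norm (c *\<^sub>C f)"
      using False by (simp add: norm_divide field_simps)
    then show ?thesis using le[of c f] by linarith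
  qed
qed

end


section \<open>Operators\<close>

text \<open>
  The type \<open>'a \<Rightarrow>\<^sub>L 'a\<close> consists of the bounded real-linear operators; the algebra $B(X)$ is its
  closed subalgebra of complex-linear ones. The norm of this type is the operator norm.
\<close>

definition complex_linear :: "('a \<Rightarrow>\<^sub>L 'a::complex_normed_vector) \<Rightarrow> bool" where
  "complex_linear T \<longleftrightarrow> (\<forall>c x. T (c *\<^sub>C x) = c *\<^sub>C T x)"

definition compact_operator :: "('a \<Rightarrow>\<^sub>L 'a::complex_normed_vector) \<Rightarrow> bool" where
  "compact_operator T \<longleftrightarrow> compact (closure (blinfun_apply T ` cball 0 1))"

definition op_power :: "('a \<Rightarrow>\<^sub>L 'a::complex_normed_vector) \<Rightarrow> nat \<Rightarrow> 'a \<Rightarrow>\<^sub>L 'a" where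
  "op_power T n = ((\<lambda>S. T o\<^sub>L S) ^^ n) id_blinfun"

definition op_poly :: "complex poly \<Rightarrow> ('a \<Rightarrow>\<^sub>L 'a::complex_normed_vector) \<Rightarrow> 'a \<Rightarrow>\<^sub>L 'a" where
  "op_poly p T = (\<Sum>i\<le>degree p. coeff p i *\<^sub>C op_power T i)"

definition well_bounded :: "('a \<Rightarrow>\<^sub>L 'a::complex_normed_vector) \<Rightarrow> bool" where
  "well_bounded T \<longleftrightarrow>
    (\<exists>a b C :: real. a \<le> b \<and>
      (\<forall>p. norm (op_poly p T) \<le>
        C * (cmod (poly p (of_real b)) + integral {a..b} (\<lambda>t. cmod (poly (pderiv p) (of_real t))))))"

definition eigenspace :: "('a \<Rightarrow>\<^sub>L 'a::complex_normed_vector) \<Rightarrow> complex \<Rightarrow> 'a set" where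
  "eigenspace T z = {x. T x = z *\<^sub>C x}"

definition eigenvalue :: "('a \<Rightarrow>\<^sub>L 'a::complex_normed_vector) \<Rightarrow> complex \<Rightarrow> bool" where
  "eigenvalue T z \<longleftrightarrow> (\<exists>x. x \<noteq> 0 \<and> x \<in> eigenspace T z)"

definition op_inverse :: "('a \<Rightarrow>\<^sub>L 'a::complex_normed_vector) \<Rightarrow> ('a \<Rightarrow>\<^sub>L 'a) \<Rightarrow> bool" where
  "op_inverse S R \<longleftrightarrow> S o\<^sub>L R = id_blinfun \<and> R o\<^sub>L S = id_blinfun"

text \<open>
  If \<open>T\<close> is complex-linear, then so is every two-sided inverse of \<open>z *\<^sub>C id_blinfun - T\<close>; hence for
  such \<open>T\<close> spectrum and resolvent are those relative to $B(X)$.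
\<close>

definition spectrum :: "('a \<Rightarrow>\<^sub>L 'a::complex_normed_vector) \<Rightarrow> complex set" where
  "spectrum T = {z. \<not> (\<exists>R. op_inverse (z *\<^sub>C id_blinfun - T) R)}"

definition resolvent :: "('a \<Rightarrow>\<^sub>L 'a::complex_normed_vector) \<Rightarrow> complex \<Rightarrow> 'a \<Rightarrow>\<^sub>L 'a" where
  "resolvent T z = (THE R. op_inverse (z *\<^sub>C id_blinfun - T) R)"

text \<open>The counterpart of \<^const>\<open>has_contour_integral\<close> for functions with values in a complex Banach space.\<close>

definition has_vector_contour_integral ::
    "(complex \<Rightarrow> 'b::complex_normed_vector) \<Rightarrow> 'b \<Rightarrow> (real \<Rightarrow> complex) \<Rightarrow> bool" where
  "has_vector_contour_integral f I g \<longleftrightarrow>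
    ((\<lambda>t. vector_derivative g (at t within {0..1}) *\<^sub>C f (g t)) has_integral I) {0..1}"

text \<open>
  \<open>P\<close> is $\frac{1}{2\pi i}\oint (z - T)^{-1}\,dz$ over a positively oriented circle around the isolated
  spectral point \<open>m\<close> that neither meets nor encloses any other point of the spectrum. The integral does
  not depend on the choice of such a circle.
\<close>

definition riesz_projection ::
    "('a \<Rightarrow>\<^sub>L 'a::complex_banach) \<Rightarrow> complex \<Rightarrow> ('a \<Rightarrow>\<^sub>L 'a) \<Rightarrow> bool" where
  "riesz_projection T m P \<longleftrightarrow>
    (\<exists>r>0. cball m r \<inter> spectrum T = {m} \<and>
      has_vector_contour_integral (resolvent T) ((2 * of_real pi * \<i>) *\<^sub>C P) (circlepath m r))"

text \<open>
  The sequences are indexed from 0. The list \<open>\<mu>\<close> is continued by zeros if there are only finitely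
  many nonzero eigenvalues; otherwise the conditions below leave no zero entry, since by monotonicity
  everything after a zero would be zero.
\<close>

definition sum_representation ::
    "('a \<Rightarrow>\<^sub>L 'a::complex_banach) \<Rightarrow> (nat \<Rightarrow> complex) \<Rightarrow> (nat \<Rightarrow> 'a \<Rightarrow>\<^sub>L 'a) \<Rightarrow> bool" where
  "sum_representation T \<mu> P \<longleftrightarrow>
    range \<mu> - {0} = {z. eigenvalue T z \<and> z \<noteq> 0} \<and>
    inj_on \<mu> {j. \<mu> j \<noteq> 0} \<and>
    antimono (\<lambda>j. cmod (\<mu> j)) \<and>
    (\<forall>j. \<mu> j \<noteq> 0 \<longrightarrow> riesz_projection T (\<mu> j) (P j) \<and> range (P j) = eigenspace T (\<mu> j)) \<and>
    (\<forall>j. \<mu> j = 0 \<longrightarrow> P j = 0) \<and>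
    (\<lambda>j. \<mu> j *\<^sub>C P j) sums T"

end

theory Submission
  imports Defs
begin

text \<open>
  For real \<open>c\<close> and large \<open>R\<close> the polynomials $(1 - (t-c)^2/R^2)^m$ are unimodal on $[a,b]$, so their
  variation is bounded in \<open>m\<close> and the operators $B_m = (1 - (T-c)^2/R^2)^m$ are uniformly bounded.
  On an eigenvector for the eigenvalue \<open>z\<close> they converge to the identity if \<open>z = c\<close> and to zero
  otherwise. Let \<open>S\<close> be the rearranged sum and \<open>D = T - S\<close>. Uniform boundedness allows one to pass
  to the limit term by term: for $c = \mu_k$ both $B_m T$ and $B_m S$ tend to $\mu_k P_k$, so
  $\mu_k P_k D = \lim B_m T D = \lim T B_m D = 0$. Summing over \<open>k\<close> gives \<open>TD = 0\<close>. For \<open>c = 0\<close> one has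
  $B_m D = D$ because \<open>TD = 0\<close>, while $B_m D \to 0$ because the eigenvalues $\mu_j$ are nonzero.
\<close>

section \<open>Polynomials in an operator and their action on eigenvectors\<close>

lemma scaleC_one: "1 *\<^sub>C x = (x::'a::complex_normed_vector)"
  using scaleC_of_real[of 1 x] by simp

lemma scaleC_zero_left: "0 *\<^sub>C x = (0::'a::complex_normed_vector)"
  using scaleC_of_real[of 0 x] by simp

lemma scaleC_zero_right: "c *\<^sub>C (0::'a::complex_normed_vector) = 0"
  using norm_scaleC[of c "0::'a"] by simp

lemma scaleC_sum_left: "(\<Sum>i\<in>A. f i) *\<^sub>C x = (\<Sum>i\<in>A. f i *\<^sub>C (x::'a::complex_normed_vector))"
  by (induction A rule: infinite_finite_induct) (auto simp: scaleC_zero_left scaleC_add_left)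

lemma blinfun_apply_sum: "blinfun_apply (\<Sum>i\<in>A. f i) x = (\<Sum>i\<in>A. blinfun_apply (f i) x)"
  by (induction A rule: infinite_finite_induct) (auto simp: blinfun.add_left)

lemma op_power_0: "op_power T 0 = id_blinfun"
  and op_power_Suc: "op_power T (Suc n) = T o\<^sub>L op_power T n"
  by (simp_all add: op_power_def)

lemma op_power_commute: "op_power T n (T x) = T (op_power T n x)"
  by (induction n) (auto simp: op_power_0 op_power_Suc)

lemma op_poly_apply: "op_poly p T x = (\<Sum>i\<le>degree p. coeff p i *\<^sub>C op_power T i x)"
  by (simp add: op_poly_def blinfun_apply_sum scaleC_blinfun.rep_eq)

lemma op_poly_commute:
  assumes "complex_linear T"
  shows "op_poly p T o\<^sub>L T = T o\<^sub>L op_poly p T"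
  using assms
  by (intro blinfun_eqI)
    (simp add: op_poly_apply op_power_commute blinfun.sum_right complex_linear_def)

lemma op_power_eigenvector:
  assumes "complex_linear T" "T x = z *\<^sub>C x"
  shows "op_power T n x = z ^ n *\<^sub>C x"
proof (induction n)
  case (Suc n)
  have "op_power T (Suc n) x = z ^ n *\<^sub>C z *\<^sub>C x"
    using assms Suc by (simp add: op_power_Suc complex_linear_def)
  then show ?case by (simp add: scaleC_scaleC mult.commute)
qed (simp add: op_power_0 scaleC_one)

lemma op_poly_eigenvector:
  assumes "complex_linear T" "T x = z *\<^sub>C x"
  shows "op_poly p T x = poly p z *\<^sub>C x"
  by (simp add: op_poly_apply op_power_eigenvector[OF assms] scaleC_scaleC poly_altdef
      scaleC_sum_left)

text \<open>The hypothesis says that \<open>V\<close> maps into the eigenspace of \<open>z\<close>,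
  so the vector version applies pointwise. It serves for the terms \<open>u j\<close> of the series
  and, with \<open>z = 0\<close>, for the difference \<open>D\<close>.\<close>

lemma op_poly_compose_eigenvector:
  assumes "complex_linear T" "T o\<^sub>L V = z *\<^sub>C V"
  shows "op_poly p T o\<^sub>L V = poly p z *\<^sub>C V"
proof (rule blinfun_eqI)
  fix x
  have "T (V x) = z *\<^sub>C V x"
    by (metis assms(2) blinfun_apply_blinfun_compose scaleC_blinfun.rep_eq)
  then show "(op_poly p T o\<^sub>L V) x = (poly p z *\<^sub>C V) x"
    by (simp add: op_poly_eigenvector[OF assms(1)] scaleC_blinfun.rep_eq)
qed

section \<open>Peak polynomials and a uniform bound for their powers\<close>

definition peak :: "real \<Rightarrow> real \<Rightarrow> complex poly" where
  "peak c R = 1 - smult (of_real (1 / R\<^sup>2)) ([:- of_real c, 1:]\<^sup>2)"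

lemma poly_peak: "poly (peak c R) z = 1 - (z - of_real c)\<^sup>2 / of_real (R\<^sup>2)"
  by (simp add: peak_def)

lemma poly_pderiv_peak_power:
  "poly (pderiv (peak c R ^ m)) (of_real t) =
    of_real (real m * (1 - (t - c)\<^sup>2 / R\<^sup>2) ^ (m - 1) * (- 2 * (t - c) / R\<^sup>2))"
proof -
  have "poly (pderiv (peak c R)) z = - 2 * (z - of_real c) / of_real (R\<^sup>2)" for z
    by (simp add: peak_def pderiv_diff pderiv_smult pderiv_power pderiv_pCons diff_divide_distrib)
  then show ?thesis
    by (simp add: pderiv_power poly_peak)
qed

text \<open>On \<open>{a..b}\<close> the base of the power lies between 0 and 1, so the power
  increases before \<open>c\<close> and decreases after it. Each monotone piece has variation at
  most 1, whatever \<open>m\<close> is. The point \<open>c\<close> may lie outside the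
  interval.\<close>

lemma peak_power_integral_le:
  assumes "a \<le> b" "R > 0" and R: "\<And>t. t \<in> {a..b} \<Longrightarrow> \<bar>t - c\<bar> \<le> R"
  shows "integral {a..b} (\<lambda>t. cmod (poly (pderiv (peak c R ^ m)) (of_real t))) \<le> 2"
proof -
  define g where "g t = (1 - (t - c)\<^sup>2 / R\<^sup>2) ^ m" for t
  define g' where "g' t = real m * (1 - (t - c)\<^sup>2 / R\<^sup>2) ^ (m - 1) * (- 2 * (t - c) / R\<^sup>2)" for t
  \<comment> \<open>An antiderivative of the absolute value of \<open>g'\<close>: since
    \<open>g c = 1\<close>, both branches vanish at \<open>c\<close> and glue continuously. The form
    of the fundamental theorem used below allows the exceptional point \<open>c\<close>, so
    continuity there suffices.\<close>
  define G where "G t = (if t \<le> c then g t - 1 else 1 - g t)" for t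
  have base: "0 \<le> 1 - (t - c)\<^sup>2 / R\<^sup>2" "1 - (t - c)\<^sup>2 / R\<^sup>2 \<le> 1" if "t \<in> {a..b}" for t
  proof -
    have "(t - c)\<^sup>2 \<le> R\<^sup>2"
      using R[OF that] assms(2) by (metis abs_le_square_iff abs_of_pos)
    then show "0 \<le> 1 - (t - c)\<^sup>2 / R\<^sup>2" using assms(2) by simp
  qed simp
  have g01: "0 \<le> g t" "g t \<le> 1" if "t \<in> {a..b}" for t
    using base[OF that] by (auto simp: g_def power_le_one)
  have dg: "(g has_real_derivative g' t) (at t)" for t
  proof -
    have "((\<lambda>t. 1 - (t - c)\<^sup>2 / R\<^sup>2) has_real_derivative - 2 * (t - c) / R\<^sup>2) (at t)"
      by (rule DERIV_cong[OF DERIV_diff[OF DERIV_const DERIV_cdivide]])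
        (auto intro!: derivative_eq_intros simp: diff_divide_distrib)
    from DERIV_power[OF this, of m] show ?thesis
      by (simp add: g_def[abs_def] g'_def mult_ac)
  qed
  have contG: "continuous_on {a..b} G"
  proof -
    have cg: "continuous_on A g" for A
      unfolding g_def using assms(2) by (intro continuous_intros) auto
    have "continuous_on ({..c} \<union> {c..}) (\<lambda>t. if t \<le> c then g t - 1 else 1 - g t)"
      using assms(2)
      by (intro continuous_on_If) (auto intro!: continuous_intros cg simp: g_def)
    then have "continuous_on ({..c} \<union> {c..}) G"
      by (simp add: G_def[abs_def])
    then show ?thesis by (rule continuous_on_subset) auto
  qed
  have "((\<lambda>t. \<bar>g' t\<bar>) has_integral (G b - G a)) {a..b}"
  proof (rule fundamental_theorem_of_calculus_interior_strong[of "{c}"])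
    fix t assume t: "t \<in> {a<..<b} - {c}"
    have "0 \<le> real m * (1 - (t - c)\<^sup>2 / R\<^sup>2) ^ (m - 1)"
      using base[of t] t by auto
    then have sgn: "t < c \<Longrightarrow> g' t \<ge> 0" "t > c \<Longrightarrow> g' t \<le> 0"
      unfolding g'_def
      by (auto intro!: mult_nonneg_nonneg mult_nonneg_nonpos divide_nonneg_nonneg
          divide_nonpos_nonneg simp del: mult_minus_left)
    have "(G has_real_derivative \<bar>g' t\<bar>) (at t)"
    proof (cases "t < c")
      case True
      have "((\<lambda>t. g t - 1) has_real_derivative \<bar>g' t\<bar>) (at t)"
        using sgn(1)[OF True] by (auto intro!: derivative_eq_intros dg)
      then show ?thesis
        by (rule has_field_derivative_transform_within_open[of _ _ _ "{..<c}"])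
          (use True in \<open>auto simp: G_def\<close>)
    next
      case False
      then have "t > c" using t by auto
      then have "((\<lambda>t. 1 - g t) has_real_derivative \<bar>g' t\<bar>) (at t)"
        using sgn(2) by (auto intro!: derivative_eq_intros dg)
      then show ?thesis
        by (rule has_field_derivative_transform_within_open[of _ _ _ "{c<..}"])
          (use \<open>t > c\<close> in \<open>auto simp: G_def\<close>)
    qed
    then show "(G has_vector_derivative \<bar>g' t\<bar>) (at t)"
      by (simp add: has_real_derivative_iff_has_vector_derivative)
  qed (use assms contG in auto)
  then have "integral {a..b} (\<lambda>t. \<bar>g' t\<bar>) = G b - G a"
    by (rule integral_unique)
  also have "\<dots> \<le> 2"
    using g01[of a] g01[of b] assms(1) by (auto simp: G_def)
  finally show ?thesis
    by (simp only: poly_pderiv_peak_power g'_def norm_of_real)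
qed

text \<open>The bound is uniform in \<open>R\<close> as well as in \<open>m\<close>; the freedom to
  enlarge \<open>R\<close> later turns a weak inequality into a strict one.\<close>

lemma well_bounded_peak_powers:
  assumes "well_bounded T"
  obtains R0 K where "R0 > 0" "\<And>R m. R \<ge> R0 \<Longrightarrow> norm (op_poly (peak c R ^ m) T) \<le> K"
proof -
  obtain a b C :: real where ab: "a \<le> b" and wb: "\<And>p. norm (op_poly p T) \<le>
      C * (cmod (poly p (of_real b)) + integral {a..b} (\<lambda>t. cmod (poly (pderiv p) (of_real t))))"
    using assms unfolding well_bounded_def by blast
  \<comment> \<open>The 3 is 1 for the value at \<open>b\<close> plus 2 for the variation; the
    absolute value is taken because \<open>C\<close> has no prescribed sign. The lower bound for
    \<open>R\<close> makes it positive and at least the distance from \<open>c\<close> to any point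
    of \<open>{a..b}\<close>.\<close>
  have "norm (op_poly (peak c R ^ m) T) \<le> \<bar>C\<bar> * 3" if "R \<ge> \<bar>a\<bar> + \<bar>b\<bar> + \<bar>c\<bar> + 1" for R m
  proof -
    have R: "R > 0" "\<And>t. t \<in> {a..b} \<Longrightarrow> \<bar>t - c\<bar> \<le> R"
      using that by auto
    let ?v = "cmod (poly (peak c R ^ m) (of_real b))"
    let ?I = "integral {a..b} (\<lambda>t. cmod (poly (pderiv (peak c R ^ m)) (of_real t)))"
    have I: "?I \<le> 2"
      by (rule peak_power_integral_le[OF ab R])
    have "(b - c)\<^sup>2 \<le> R\<^sup>2"
      using R(2)[of b] R(1) ab by (metis abs_le_square_iff abs_of_pos atLeastAtMost_iff order_refl)
    then have "\<bar>1 - (b - c)\<^sup>2 / R\<^sup>2\<bar> \<le> 1"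
      using R(1) by (simp add: abs_le_iff field_simps)
    moreover have "poly (peak c R) (of_real b) = of_real (1 - (b - c)\<^sup>2 / R\<^sup>2)"
      by (simp add: poly_peak)
    ultimately have "?v \<le> 1"
      by (simp only: poly_power norm_power norm_of_real) (simp add: power_le_one)
    \<comment> \<open>The product estimate needs a nonnegative second factor. The integral of a
      nonintegrable function is 0 by convention, so both cases are harmless.\<close>
    moreover have "?I \<ge> 0"
      by (cases "(\<lambda>t. cmod (poly (pderiv (peak c R ^ m)) (of_real t))) integrable_on {a..b}")
        (auto intro: integral_nonneg simp: not_integrable_integral)
    ultimately have "C * (?v + ?I) \<le> \<bar>C\<bar> * 3"
      using I by (intro mult_mono) auto
    then show ?thesis using wb order_trans by blast
  qed
  then show thesis
    by (intro that[of "\<bar>a\<bar> + \<bar>b\<bar> + \<bar>c\<bar> + 1" "\<bar>C\<bar> * 3"]) auto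
qed

section \<open>Location of the eigenvalues\<close>

lemma norm_le_one_if_powers_bounded:
  fixes w :: "'a::real_normed_div_algebra"
  assumes "\<And>m. norm (w ^ m) \<le> K"
  shows "norm w \<le> 1"
proof (rule ccontr)
  assume "\<not> norm w \<le> 1"
  then obtain n where "K < norm w ^ n"
    using real_arch_pow[of "norm w" K] by auto
  then show False using assms[of n] by (simp add: norm_power)
qed

text \<open>On an eigenvector the operators act as the powers of the number
  \<open>poly (peak c R) z\<close>; these stay bounded by \<open>K\<close>, which excludes modulus
  above 1.\<close>

lemma eigenvalue_peak_le_one:
  assumes "complex_linear T" "eigenvalue T z"
    and "\<And>m. norm (op_poly (peak c R ^ m) T) \<le> K"
  shows "cmod (poly (peak c R) z) \<le> 1"
proof (rule norm_le_one_if_powers_bounded)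
  fix m
  obtain x where x: "x \<noteq> 0" "T x = z *\<^sub>C x"
    using assms(2) by (auto simp: eigenvalue_def eigenspace_def)
  have "cmod (poly (peak c R) z ^ m) * norm x = norm (op_poly (peak c R ^ m) T x)"
    by (simp add: op_poly_eigenvector[OF assms(1) x(2)] norm_scaleC)
  also have "\<dots> \<le> K * norm x"
    using norm_blinfun assms(3) by (meson mult_right_mono norm_ge_zero order_trans)
  finally show "cmod (poly (peak c R) z ^ m) \<le> K"
    using x by simp
qed

text \<open>Centred at \<open>Re z\<close>, the peak polynomial takes at \<open>z\<close> a real
  value that exceeds 1 unless \<open>Im z = 0\<close>.\<close>

lemma well_bounded_eigenvalue_real:
  assumes "complex_linear T" "well_bounded T" "eigenvalue T z"
  shows "z = of_real (Re z)"
proof -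
  obtain R K where R: "R > 0" "\<And>R' m. R' \<ge> R \<Longrightarrow> norm (op_poly (peak (Re z) R' ^ m) T) \<le> K"
    using well_bounded_peak_powers[OF assms(2)] by metis
  have "z - of_real (Re z) = \<i> * of_real (Im z)"
    by (simp add: complex_eq_iff)
  then have "poly (peak (Re z) R) z = of_real (1 + (Im z)\<^sup>2 / R\<^sup>2)"
    by (simp add: poly_peak power_mult_distrib)
  moreover have "cmod (poly (peak (Re z) R) z) \<le> 1"
    using eigenvalue_peak_le_one[OF assms(1,3)] R(2) by blast
  ultimately have "\<bar>1 + (Im z)\<^sup>2 / R\<^sup>2\<bar> \<le> 1"
    by (simp only: norm_of_real)
  then have "(Im z)\<^sup>2 / R\<^sup>2 \<le> 0" by linarith
  then have "Im z = 0" using R(1) by (simp add: divide_le_0_iff)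
  then show ?thesis by (simp add: complex_eq_iff)
qed

lemma well_bounded_peak_contraction:
  assumes "complex_linear T" "well_bounded T"
  obtains R K where "\<And>m. norm (op_poly (peak c R ^ m) T) \<le> K"
    and "\<And>z. eigenvalue T z \<Longrightarrow> z \<noteq> of_real c \<Longrightarrow> cmod (poly (peak c R) z) < 1"
proof -
  obtain R K where R: "R > 0" "\<And>R' m. R' \<ge> R \<Longrightarrow> norm (op_poly (peak c R' ^ m) T) \<le> K"
    using well_bounded_peak_powers[OF assms(2)] by metis
  \<comment> \<open>With radius \<open>R\<close> the value \<open>1 - s / R^2\<close> could still be
    -1. Passing to \<open>R + 1\<close> decreases the quotient strictly, so it falls below 2 while
    staying positive.\<close>
  have "cmod (poly (peak c (R + 1)) z) < 1" if z: "eigenvalue T z" "z \<noteq> of_real c" for z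
  proof -
    define s where "s = (Re z - c)\<^sup>2"
    have zr: "z = of_real (Re z)"
      by (rule well_bounded_eigenvalue_real[OF assms z(1)])
    then have "s > 0" using z(2) by (auto simp: s_def)
    have eq: "poly (peak c R') z = of_real (1 - s / R'\<^sup>2)" for R'
      by (subst zr) (simp add: poly_peak s_def)
    have "cmod (poly (peak c R) z) \<le> 1"
      using eigenvalue_peak_le_one[OF assms(1) z(1)] R(2) by blast
    then have "s / R\<^sup>2 \<le> 2" unfolding eq norm_of_real by linarith
    moreover have "s / (R + 1)\<^sup>2 < s / R\<^sup>2"
      using \<open>s > 0\<close> R(1) by (intro divide_strict_left_mono power_strict_mono mult_pos_pos) auto
    moreover have "s / (R + 1)\<^sup>2 > 0" using \<open>s > 0\<close> R(1) by simp
    ultimately show ?thesis unfolding eq norm_of_real by linarith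
  qed
  with R that[of "R + 1" K] show thesis by auto
qed

section \<open>Termwise limits and the rearranged sum\<close>

text \<open>A three-epsilon argument: the bound \<open>K\<close> controls the remainder of
  \<open>u\<close> uniformly in \<open>m\<close>, and on a finite partial sum the limit is taken
  term by term. Norm convergence of the series in its given order is enough, so the lemma applies to
  both orderings.\<close>

lemma bounded_compose_sums_tendsto:
  fixes B :: "nat \<Rightarrow> 'b::real_normed_vector \<Rightarrow>\<^sub>L 'c::real_normed_vector"
    and u :: "nat \<Rightarrow> 'a::real_normed_vector \<Rightarrow>\<^sub>L 'b"
  assumes K: "\<And>m. norm (B m) \<le> K" and U: "u sums U" and L: "L sums W"
    and lim: "\<And>j. (\<lambda>m. B m o\<^sub>L u j) \<longlonglongrightarrow> L j"
  shows "(\<lambda>m. B m o\<^sub>L U) \<longlonglongrightarrow> W"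
proof (rule tendstoI)
  fix e :: real assume e: "e > 0"
  have K0: "K \<ge> 0" using K[of 0] norm_ge_zero order_trans by blast
  \<comment> \<open>The summand 1 keeps the denominator positive when \<open>K = 0\<close> and makes
    \<open>K * d < e / 3\<close> strict.\<close>
  define d where "d = e / (3 * (K + 1))"
  have d: "d > 0" "K * d < e / 3"
    using e K0 by (auto simp: d_def field_simps)
  have "\<forall>\<^sub>F n in sequentially. dist (\<Sum>j<n. u j) U < d"
    using U d(1) unfolding sums_def by (rule tendstoD)
  moreover have "\<forall>\<^sub>F n in sequentially. dist (\<Sum>j<n. L j) W < e / 3"
    using L e unfolding sums_def by (intro tendstoD) auto
  ultimately have "\<forall>\<^sub>F n in sequentially. dist (\<Sum>j<n. u j) U < d \<and> dist (\<Sum>j<n. L j) W < e / 3"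
    by (rule eventually_conj)
  then obtain n where n: "dist (\<Sum>j<n. u j) U < d" "dist (\<Sum>j<n. L j) W < e / 3"
    using eventually_happens'[OF sequentially_bot] by blast
  have "(\<lambda>m. \<Sum>j<n. B m o\<^sub>L u j) \<longlonglongrightarrow> (\<Sum>j<n. L j)"
    by (intro tendsto_sum lim)
  then have "\<forall>\<^sub>F m in sequentially. dist (\<Sum>j<n. B m o\<^sub>L u j) (\<Sum>j<n. L j) < e / 3"
    using e by (intro tendstoD) auto
  then show "\<forall>\<^sub>F m in sequentially. dist (B m o\<^sub>L U) W < e"
  proof eventually_elim
    case (elim m)
    have sum: "(\<Sum>j<n. B m o\<^sub>L u j) = B m o\<^sub>L (\<Sum>j<n. u j)"
      by (simp add: bounded_bilinear.sum_right[OF bounded_bilinear_blinfun_compose])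
    have "dist (B m o\<^sub>L U) (B m o\<^sub>L (\<Sum>j<n. u j)) = norm (B m o\<^sub>L (U - (\<Sum>j<n. u j)))"
      by (simp add: dist_norm bounded_bilinear.diff_right[OF bounded_bilinear_blinfun_compose])
    also have "\<dots> \<le> norm (B m) * norm (U - (\<Sum>j<n. u j))"
      by (rule norm_blinfun_compose)
    also have "\<dots> \<le> K * d"
      using K n(1) K0 by (intro mult_mono) (auto simp: dist_norm norm_minus_commute)
    finally have "dist (B m o\<^sub>L U) (B m o\<^sub>L (\<Sum>j<n. u j)) < e / 3"
      using d by linarith
    with elim n(2) show ?case
      unfolding sum
      using dist_triangle[of "B m o\<^sub>L U" W "B m o\<^sub>L (\<Sum>j<n. u j)"]
        dist_triangle[of "B m o\<^sub>L (\<Sum>j<n. u j)" W "\<Sum>j<n. L j"] by linarith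
  qed
qed

lemma scaleC_power_tendsto_0:
  assumes "cmod w < 1"
  shows "(\<lambda>m. w ^ m *\<^sub>C (x::'a::complex_normed_vector)) \<longlonglongrightarrow> 0"
proof (rule tendsto_norm_zero_cancel)
  have "(\<lambda>m. cmod w ^ m * norm x) \<longlonglongrightarrow> 0 * norm x"
    using assms by (intro tendsto_intros LIMSEQ_power_zero) auto
  then show "(\<lambda>m. norm (w ^ m *\<^sub>C x)) \<longlonglongrightarrow> 0"
    by (simp add: norm_scaleC norm_power)
qed

theorem corollary7p2:
  fixes T :: "'a::complex_banach \<Rightarrow>\<^sub>L 'a"
    and \<mu> :: "nat \<Rightarrow> complex"
    and P :: "nat \<Rightarrow> 'a \<Rightarrow>\<^sub>L 'a"
    and \<pi> :: "nat \<Rightarrow> nat"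
  assumes "complex_linear T"
    and "compact_operator T"
    and "well_bounded T"
    and "sum_representation T \<mu> P"
    and "bij \<pi>"
    and "summable (\<lambda>j. \<mu> (\<pi> j) *\<^sub>C P (\<pi> j))"
  shows "T = (\<Sum>j. \<mu> (\<pi> j) *\<^sub>C P (\<pi> j))"
proof -
  define u where "u j = \<mu> j *\<^sub>C P j" for j
  define S where "S = (\<Sum>j. u (\<pi> j))"
  define D where "D = T - S"
  have ev: "eigenvalue T (\<mu> j)" if "\<mu> j \<noteq> 0" for j
    using assms(4) that unfolding sum_representation_def by blast
  have inj: "inj_on \<mu> {j. \<mu> j \<noteq> 0}"
    and ran: "\<And>j. \<mu> j \<noteq> 0 \<Longrightarrow> range (P j) = eigenspace T (\<mu> j)"
    and T: "u sums T"
    using assms(4) unfolding sum_representation_def u_def by blast+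
  have S: "(\<lambda>j. u (\<pi> j)) sums S"
    using assms(6) by (simp add: u_def S_def summable_sums)
  have u0: "u j = 0" if "\<mu> j = 0" for j
    using that by (simp add: u_def scaleC_zero_left)
  have Tu: "T o\<^sub>L u j = \<mu> j *\<^sub>C u j" for j
  proof (cases "\<mu> j = 0")
    case True
    then show ?thesis by (simp add: u0 scaleC_zero_right)
  next
    case False
    have "T (P j x) = \<mu> j *\<^sub>C P j x" for x
      using ran[OF False] by (auto simp: eigenspace_def)
    then show ?thesis
      using assms(1)
      by (intro blinfun_eqI) (simp add: u_def scaleC_blinfun.rep_eq complex_linear_def)
  qed
  have lim: "(\<lambda>m. op_poly (peak c R ^ m) T o\<^sub>L u j) \<longlonglongrightarrow> (if \<mu> j = of_real c then u j else 0)"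
    if "\<And>z. eigenvalue T z \<Longrightarrow> z \<noteq> of_real c \<Longrightarrow> cmod (poly (peak c R) z) < 1" for c R j
  \<comment> \<open>Zero entries of \<mu> are treated separately because 0 need not be an
    eigenvalue; there \<open>u j = 0\<close>, so both values of the limit agree.\<close>
  proof (cases "\<mu> j = 0 \<or> \<mu> j = of_real c")
    case True
    then show ?thesis
      by (auto simp: u0 op_poly_compose_eigenvector[OF assms(1) Tu] poly_peak scaleC_one
          scaleC_zero_right)
  next
    case False
    then show ?thesis
      using scaleC_power_tendsto_0[OF that[OF ev], of j "u j"]
      by (simp add: op_poly_compose_eigenvector[OF assms(1) Tu])
  qed
  note cdiff = bounded_bilinear.diff_right[OF bounded_bilinear_blinfun_compose]
    bounded_bilinear.diff_left[OF bounded_bilinear_blinfun_compose]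
  have uD: "u k o\<^sub>L D = 0" for k
  proof (cases "\<mu> k = 0")
    case False
    define c where "c = Re (\<mu> k)"
    have c: "\<mu> k = of_real c"
      unfolding c_def by (rule well_bounded_eigenvalue_real[OF assms(1,3) ev[OF False]])
    obtain R K where K: "\<And>m. norm (op_poly (peak c R ^ m) T) \<le> K"
      and R: "\<And>z. eigenvalue T z \<Longrightarrow> z \<noteq> of_real c \<Longrightarrow> cmod (poly (peak c R) z) < 1"
      using well_bounded_peak_contraction[OF assms(1,3)] by metis
    define B where "B m = op_poly (peak c R ^ m) T" for m
    have BK: "norm (B m) \<le> K" for m by (simp add: B_def K)
    have only: "\<mu> j = of_real c \<longleftrightarrow> j = k" for j
      using inj False c by (auto simp: inj_on_def)
    have lim': "(\<lambda>m. B m o\<^sub>L u j) \<longlonglongrightarrow> (if j = k then u j else 0)" for j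
      using lim[OF R, of j] by (simp add: B_def only)
    have BT: "(\<lambda>m. B m o\<^sub>L T) \<longlonglongrightarrow> u k"
      by (rule bounded_compose_sums_tendsto[OF BK T sums_single[of k u] lim'])
    \<comment> \<open>The bijection puts \<open>u k\<close> at exactly one place of the rearranged
      series, so the termwise limits again add up to \<open>u k\<close> and cancel in
      \<open>D\<close>.\<close>
    obtain i where i: "\<pi> i = k" using assms(5) by (metis bij_pointE)
    have "\<pi> j = k \<longleftrightarrow> j = i" for j
      using i assms(5) by (metis bij_pointE)
    then have "(\<lambda>j. if \<pi> j = k then u (\<pi> j) else 0) sums u k"
      using sums_single[of i "\<lambda>j. u (\<pi> j)"] i by simp
    then have BS: "(\<lambda>m. B m o\<^sub>L S) \<longlonglongrightarrow> u k"
      by (intro bounded_compose_sums_tendsto[OF BK S _ lim'])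
    have "(\<lambda>m. B m o\<^sub>L D) \<longlonglongrightarrow> 0"
      using tendsto_diff[OF BT BS] by (simp add: D_def cdiff)
    then have "(\<lambda>m. T o\<^sub>L (B m o\<^sub>L D)) \<longlonglongrightarrow> (T o\<^sub>L 0)"
      by (intro bounded_bilinear.tendsto[OF bounded_bilinear_blinfun_compose] tendsto_const)
    moreover have "(\<lambda>m. (B m o\<^sub>L T) o\<^sub>L D) \<longlonglongrightarrow> (u k o\<^sub>L D)"
      by (intro bounded_bilinear.tendsto[OF bounded_bilinear_blinfun_compose] tendsto_const BT)
    moreover have "(B m o\<^sub>L T) o\<^sub>L D = T o\<^sub>L (B m o\<^sub>L D)" for m
      unfolding B_def op_poly_commute[OF assms(1)] by (rule blinfun_eqI) simp
    ultimately show ?thesis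
      using LIMSEQ_unique by force
  qed (simp add: u0)
  have "(\<lambda>k. u k o\<^sub>L D) sums (T o\<^sub>L D)"
    by (rule bounded_linear.sums[OF bounded_bilinear.bounded_linear_left
          [OF bounded_bilinear_blinfun_compose] T])
  then have "T o\<^sub>L D = 0"
    by (simp add: uD sums_unique2[OF _ sums_zero])
  \<comment> \<open>Written as an eigenvalue equation for 0, so that \<open>B m\<close> acts on
    \<open>D\<close> as the scalar \<open>poly (peak 0 R ^ m) 0 = 1\<close>.\<close>
  then have TD: "T o\<^sub>L D = 0 *\<^sub>C D" by (simp add: scaleC_zero_left)
  obtain R K where K: "\<And>m. norm (op_poly (peak 0 R ^ m) T) \<le> K"
    and R: "\<And>z. eigenvalue T z \<Longrightarrow> z \<noteq> of_real 0 \<Longrightarrow> cmod (poly (peak 0 R) z) < 1"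
    using well_bounded_peak_contraction[OF assms(1,3)] by metis
  define B where "B m = op_poly (peak 0 R ^ m) T" for m
  have BK: "norm (B m) \<le> K" for m by (simp add: B_def K)
  \<comment> \<open>For \<open>c = 0\<close> the branch of \<open>lim\<close> that keeps
    \<open>u j\<close> occurs only if \<mu> vanishes at \<open>j\<close>, and then
    \<open>u j = 0\<close> as well.\<close>
  have lim0: "(\<lambda>m. B m o\<^sub>L u j) \<longlonglongrightarrow> 0" for j
    using lim[OF R, of j] by (simp add: B_def u0 split: if_splits)
  have "(\<lambda>m. B m o\<^sub>L T) \<longlonglongrightarrow> 0" "(\<lambda>m. B m o\<^sub>L S) \<longlonglongrightarrow> 0"
    by (rule bounded_compose_sums_tendsto[OF BK T sums_zero lim0]
        bounded_compose_sums_tendsto[OF BK S sums_zero lim0])+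
  then have "(\<lambda>m. B m o\<^sub>L D) \<longlonglongrightarrow> 0"
    using tendsto_diff by (fastforce simp: D_def cdiff)
  moreover have "B m o\<^sub>L D = D" for m
    by (simp add: B_def op_poly_compose_eigenvector[OF assms(1) TD] poly_peak scaleC_one)
  ultimately have "D = 0"
    by (simp add: LIMSEQ_const_iff)
  then show ?thesis by (simp add: D_def S_def u_def)
qed

end
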